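(* Let $H$ be any crystal on $\mathbb Z$. Then $\langle\delta_0,e^{-itH}\delta_0\rangle$ cannot decay exponentially as $|t|\to\infty$, i.e. there are no constants $C,c>0$ such that $|\langle\delta_0,e^{-itH}\delta_0\rangle|\le Ce^{-c|t|}$ for all sufficiently large $|t|$. In particular, exponential dispersion is impossible: there are no $C,c>0$ such that $\|e^{-itH}\|_{\ell^1(\mathbb Z)\to\ell^\infty(\mathbb Z)}\le Ce^{-c|t|}$ for all sufficiently large $|t|$.
   Context: A crystal on $\mathbb Z$ is an operator $H=H_{\mathbf w}$ on $\ell^2(\mathbb Z)$ of the form $(H_{\mathbf w}u)(n)=\sum_{k\in\mathbb Z}w_k\,u(n+k)$, where $\mathbf w=(w_k)_{k\in\mathbb Z}\in\ell^1(\mathbb Z)$ satisfies $w_{-k}=w_k$ and $w_k\ge0$ for all $k$. It is bounded and self-adjoint. $(\delta_n)_{n\in\mathbb Z}$ is the standard basis of $\ell^2(\mathbb Z)$, and $\|A\|_{\ell^1\to\ell^\infty}=\sup_{n,m\in\mathbb Z}|\langle\delta_n,A\delta_m\rangle|$. *)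

theory Defs
  imports "HOL-Analysis.Analysis"
begin

section \<open>The Hilbert space of square-summable sequences indexed by the integers\<close>

typedef ell2 = "{u :: int \<Rightarrow> complex. (\<lambda>n. (cmod (u n))\<^sup>2) summable_on UNIV}"
  morphisms ell2_nth Abs_ell2
  by (rule exI[of _ "\<lambda>_. 0"]) simp

setup_lifting type_definition_ell2

lemma ell2_eqI: "(\<And>n. ell2_nth u n = ell2_nth v n) \<Longrightarrow> u = v"
  by (metis ell2_nth_inject ext)

lemma ell2_nth_summable: "(\<lambda>n. (cmod (ell2_nth u n))\<^sup>2) summable_on UNIV"
  using ell2_nth[of u] by simp

lemma cmod_add_square_le: "(cmod (a + b))\<^sup>2 \<le> 2 * (cmod a)\<^sup>2 + 2 * (cmod b)\<^sup>2"
proof -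
  have "(cmod (a + b))\<^sup>2 \<le> (cmod a + cmod b)\<^sup>2"
    by (intro power_mono norm_triangle_ineq norm_ge_zero)
  also have "\<dots> \<le> 2 * (cmod a)\<^sup>2 + 2 * (cmod b)\<^sup>2"
    using sum_squares_ge_zero[of "cmod a - cmod b" 0] by (simp add: power2_eq_square algebra_simps)
  finally show ?thesis .
qed

lemma square_summable_add:
  fixes u v :: "int \<Rightarrow> complex"
  assumes "(\<lambda>n. (cmod (u n))\<^sup>2) summable_on UNIV" "(\<lambda>n. (cmod (v n))\<^sup>2) summable_on UNIV"
  shows "(\<lambda>n. (cmod (u n + v n))\<^sup>2) summable_on UNIV"
proof (rule summable_on_comparison_test)
  show "(\<lambda>n. 2 * (cmod (u n))\<^sup>2 + 2 * (cmod (v n))\<^sup>2) summable_on UNIV"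
    by (intro summable_on_add summable_on_cmult_right assms)
qed (auto intro: cmod_add_square_le)

lemma square_summable_cmult:
  fixes u :: "int \<Rightarrow> complex"
  assumes "(\<lambda>n. (cmod (u n))\<^sup>2) summable_on UNIV"
  shows "(\<lambda>n. (cmod (c * u n))\<^sup>2) summable_on UNIV"
  using summable_on_cmult_right[OF assms, of "(cmod c)\<^sup>2"]
  by (simp add: norm_mult power_mult_distrib)

lemma cmod_mult_le_squares: "cmod (a * b) \<le> (cmod a)\<^sup>2 + (cmod b)\<^sup>2"
proof -
  have "2 * (cmod a * cmod b) \<le> (cmod a)\<^sup>2 + (cmod b)\<^sup>2"
    using sum_squares_ge_zero[of "cmod a - cmod b" 0] by (simp add: power2_eq_square algebra_simps)
  moreover have "0 \<le> cmod a * cmod b" by simp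
  ultimately show ?thesis unfolding norm_mult by linarith
qed

lemma ell2_cinner_summable: "(\<lambda>n. cnj (ell2_nth u n) * ell2_nth v n) summable_on UNIV"
proof (rule Infinite_Sum.abs_summable_summable, rule Infinite_Sum.abs_summable_on_comparison_test)
  show "(\<lambda>n. norm ((cmod (ell2_nth u n))\<^sup>2 + (cmod (ell2_nth v n))\<^sup>2)) summable_on UNIV"
    using summable_on_add[OF ell2_nth_summable ell2_nth_summable] by simp
  show "norm (cnj (ell2_nth u n) * ell2_nth v n)
      \<le> norm ((cmod (ell2_nth u n))\<^sup>2 + (cmod (ell2_nth v n))\<^sup>2)" for n
    using cmod_mult_le_squares[of "cnj (ell2_nth u n)" "ell2_nth v n"] by simp
qed

lemma ell2_inner_summable: "(\<lambda>n. ell2_nth u n \<bullet> ell2_nth v n) summable_on UNIV"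
  using summable_on_Re[OF ell2_cinner_summable[of u v]] by (simp add: inner_complex_def)

instantiation ell2 :: real_inner
begin

lift_definition zero_ell2 :: ell2 is "\<lambda>_. 0" by simp
lift_definition plus_ell2 :: "ell2 \<Rightarrow> ell2 \<Rightarrow> ell2" is "\<lambda>u v n. u n + v n"
  by (rule square_summable_add)
lift_definition uminus_ell2 :: "ell2 \<Rightarrow> ell2" is "\<lambda>u n. - u n" by simp
lift_definition minus_ell2 :: "ell2 \<Rightarrow> ell2 \<Rightarrow> ell2" is "\<lambda>u v n. u n - v n"
  using square_summable_add[of _ "\<lambda>n. - v n" for v] by simp
lift_definition scaleR_ell2 :: "real \<Rightarrow> ell2 \<Rightarrow> ell2" is "\<lambda>r u n. r *\<^sub>R u n"
  using square_summable_cmult by (simp add: scaleR_conv_of_real)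

definition inner_ell2 :: "ell2 \<Rightarrow> ell2 \<Rightarrow> real" where
  "inner_ell2 u v = (\<Sum>\<^sub>\<infinity>n. ell2_nth u n \<bullet> ell2_nth v n)"
definition norm_ell2 :: "ell2 \<Rightarrow> real" where
  "norm_ell2 u = sqrt (\<Sum>\<^sub>\<infinity>n. (cmod (ell2_nth u n))\<^sup>2)"
definition sgn_ell2 :: "ell2 \<Rightarrow> ell2" where
  "sgn_ell2 u = inverse (norm u) *\<^sub>R u"
definition dist_ell2 :: "ell2 \<Rightarrow> ell2 \<Rightarrow> real" where
  "dist_ell2 u v = norm (u - v)"
definition uniformity_ell2 :: "(ell2 \<times> ell2) filter" where
  "uniformity_ell2 = (INF e\<in>{0<..}. principal {(u, v). dist u v < e})"
definition open_ell2 :: "ell2 set \<Rightarrow> bool" where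
  "open_ell2 U = (\<forall>u\<in>U. eventually (\<lambda>(u', v). u' = u \<longrightarrow> v \<in> U) uniformity)"

instance
proof
  fix u v w :: ell2 and r s :: real
  show "u + v + w = u + (v + w)" by transfer (simp add: add.assoc)
  show "u + v = v + u" by transfer (simp add: add.commute)
  show "0 + u = u" by transfer simp
  show "- u + u = 0" by transfer simp
  show "u - v = u + - v" by transfer simp
  show "r *\<^sub>R (u + v) = r *\<^sub>R u + r *\<^sub>R v" by transfer (simp add: scaleR_add_right)
  show "(r + s) *\<^sub>R u = r *\<^sub>R u + s *\<^sub>R u" by transfer (simp add: scaleR_add_left)
  show "r *\<^sub>R s *\<^sub>R u = (r * s) *\<^sub>R u" by transfer simp
  show "1 *\<^sub>R u = u" by transfer simp
  show "sgn u = inverse (norm u) *\<^sub>R u" by (rule sgn_ell2_def)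
  show "dist u v = norm (u - v)" by (rule dist_ell2_def)
  show "(uniformity :: (ell2 \<times> ell2) filter) = (INF e\<in>{0<..}. principal {(u, v). dist u v < e})"
    by (rule uniformity_ell2_def)
  show "open U = (\<forall>u\<in>U. eventually (\<lambda>(u', v). u' = u \<longrightarrow> v \<in> U) uniformity)"
    for U :: "ell2 set" by (rule open_ell2_def)
  show "inner u v = inner v u" by (simp add: inner_ell2_def inner_commute)
  show "inner (u + v) w = inner u w + inner v w"
    unfolding inner_ell2_def plus_ell2.rep_eq inner_add_left
    by (rule infsum_add) (rule ell2_inner_summable)+
  show "inner (r *\<^sub>R u) v = r * inner u v"
    by (simp add: inner_ell2_def scaleR_ell2.rep_eq infsum_cmult_right')
  show "0 \<le> inner u u"
    unfolding inner_ell2_def by (rule infsum_nonneg) simp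
  show "(inner u u = 0) = (u = 0)"
  proof
    assume a: "inner u u = 0"
    show "u = 0"
    proof (rule ell2_eqI)
      fix n
      have "ell2_nth u n \<bullet> ell2_nth u n = 0"
        by (rule nonneg_infsum_le_0D[of "\<lambda>n. ell2_nth u n \<bullet> ell2_nth u n" UNIV])
          (use a ell2_inner_summable in \<open>simp_all add: inner_ell2_def\<close>)
      then show "ell2_nth u n = ell2_nth 0 n" by (simp add: zero_ell2.rep_eq)
    qed
  qed (simp add: inner_ell2_def zero_ell2.rep_eq)
  show "norm u = sqrt (inner u u)"
    by (simp add: inner_ell2_def norm_ell2_def power2_norm_eq_inner)
qed

end

lemmas ell2_nth_simps [simp] =
  zero_ell2.rep_eq plus_ell2.rep_eq uminus_ell2.rep_eq minus_ell2.rep_eq scaleR_ell2.rep_eq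

lemma norm_ell2_square: "(norm u)\<^sup>2 = (\<Sum>\<^sub>\<infinity>n. (cmod (ell2_nth u n))\<^sup>2)"
  unfolding norm_ell2_def by (intro real_sqrt_pow2 infsum_nonneg) simp

lemma sum_ell2_nth_le_norm:
  assumes "finite F"
  shows "(\<Sum>n\<in>F. (cmod (ell2_nth u n))\<^sup>2) \<le> (norm u)\<^sup>2"
  unfolding norm_ell2_square
  by (rule finite_sum_le_infsum) (use assms ell2_nth_summable in simp_all)

lemma cmod_ell2_nth_le_norm: "cmod (ell2_nth u n) \<le> norm u"
proof (rule power2_le_imp_le)
  have "(\<Sum>k\<in>{n}. (cmod (ell2_nth u k))\<^sup>2) \<le> (norm u)\<^sup>2"
    by (rule sum_ell2_nth_le_norm) (rule finite.intros)+
  then show "(cmod (ell2_nth u n))\<^sup>2 \<le> (norm u)\<^sup>2"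
    by (simp only: sum.insert finite.emptyI empty_iff sum.empty add_0_right not_False_eq_True)
qed (rule norm_ge_zero)

lemma bounded_linear_ell2_nth: "bounded_linear (\<lambda>u. ell2_nth u n)"
  by (rule bounded_linear_intro[of _ 1]) (simp_all add: cmod_ell2_nth_le_norm)

lemma ell2_of_finite_sums:
  fixes f :: "int \<Rightarrow> complex"
  assumes "\<And>F. finite F \<Longrightarrow> (\<Sum>n\<in>F. (cmod (f n))\<^sup>2) \<le> e\<^sup>2" and "0 \<le> e"
  shows "\<exists>u. ell2_nth u = f \<and> norm u \<le> e"
proof -
  have s: "(\<lambda>n. (cmod (f n))\<^sup>2) summable_on UNIV"
    by (rule nonneg_bdd_above_summable_on) (use assms in \<open>auto intro!: bdd_aboveI2\<close>)
  then have n: "ell2_nth (Abs_ell2 f) = f" by (simp add: Abs_ell2_inverse)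
  have "(norm (Abs_ell2 f))\<^sup>2 \<le> e\<^sup>2"
    unfolding norm_ell2_square n by (rule infsum_le_finite_sums) (use s assms in auto)
  then have "norm (Abs_ell2 f) \<le> e" using assms(2) by (rule power2_le_imp_le)
  then show ?thesis using n by blast
qed

instance ell2 :: banach
proof
  fix X :: "nat \<Rightarrow> ell2"
  assume X: "Cauchy X"
  define f where "f n = lim (\<lambda>m. ell2_nth (X m) n)" for n
  have f: "(\<lambda>m. ell2_nth (X m) n) \<longlonglongrightarrow> f n" for n
    unfolding f_def
    by (intro convergent_LIMSEQ_iff[THEN iffD1] Cauchy_convergent
        bounded_linear.Cauchy[OF bounded_linear_ell2_nth X])
  have tail: "\<exists>M. \<forall>m\<ge>M. \<exists>d. ell2_nth d = (\<lambda>n. ell2_nth (X m) n - f n) \<and> norm d \<le> e"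
    if e: "0 < e" for e
  proof -
    obtain M where M: "\<And>m k. m \<ge> M \<Longrightarrow> k \<ge> M \<Longrightarrow> norm (X m - X k) < e"
      using CauchyD[OF X e] by blast
    have "\<exists>d. ell2_nth d = (\<lambda>n. ell2_nth (X m) n - f n) \<and> norm d \<le> e" if m: "m \<ge> M" for m
    proof (rule ell2_of_finite_sums)
      fix F :: "int set" assume F: "finite F"
      have "(\<lambda>k. \<Sum>n\<in>F. (cmod (ell2_nth (X m) n - ell2_nth (X k) n))\<^sup>2)
          \<longlonglongrightarrow> (\<Sum>n\<in>F. (cmod (ell2_nth (X m) n - f n))\<^sup>2)"
        by (intro tendsto_intros f)
      moreover have "\<forall>k\<ge>M. (\<Sum>n\<in>F. (cmod (ell2_nth (X m) n - ell2_nth (X k) n))\<^sup>2) \<le> e\<^sup>2"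
      proof (intro allI impI)
        fix k assume "k \<ge> M"
        then have "(norm (X m - X k))\<^sup>2 \<le> e\<^sup>2"
          using M[OF m, of k] by (intro power_mono) simp_all
        then show "(\<Sum>n\<in>F. (cmod (ell2_nth (X m) n - ell2_nth (X k) n))\<^sup>2) \<le> e\<^sup>2"
          using order_trans[OF sum_ell2_nth_le_norm[OF F, of "X m - X k"]] by simp
      qed
      ultimately show "(\<Sum>n\<in>F. (cmod (ell2_nth (X m) n - f n))\<^sup>2) \<le> e\<^sup>2"
        by (intro LIMSEQ_le_const2) blast+
    qed (use e in simp)
    then show ?thesis by blast
  qed
  obtain m0 d0 where d0: "ell2_nth d0 = (\<lambda>n. ell2_nth (X m0) n - f n)"
    using tail[OF zero_less_one] by blast
  define L where "L = X m0 - d0"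
  have L: "ell2_nth L n = f n" for n by (simp add: L_def d0)
  have "X \<longlonglongrightarrow> L"
  proof (rule LIMSEQ_I)
    fix r :: real assume r: "0 < r"
    obtain M where M: "\<And>m. m \<ge> M \<Longrightarrow>
        \<exists>d. ell2_nth d = (\<lambda>n. ell2_nth (X m) n - f n) \<and> norm d \<le> r / 2"
      using tail[OF half_gt_zero[OF r]] by blast
    have "norm (X m - L) < r" if m: "m \<ge> M" for m
    proof -
      obtain d where d: "ell2_nth d = (\<lambda>n. ell2_nth (X m) n - f n)" "norm d \<le> r / 2"
        using M[OF m] by blast
      have "X m - L = d" by (rule ell2_eqI) (simp add: d(1) L)
      then show ?thesis using d(2) r by simp
    qed
    then show "\<exists>no. \<forall>n\<ge>no. norm (X n - L) < r" by blast
  qed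
  then show "convergent X" by (rule convergentI)
qed

text \<open>
  The class instance above only records the real structure of the space; complex scalars and the
  complex inner product (antilinear in the first argument) are the following.  The real inner
  product of the instance is the real part of \<^term>\<open>cinner\<close>.
\<close>

lift_definition cscale :: "complex \<Rightarrow> ell2 \<Rightarrow> ell2" is "\<lambda>c u n. c * u n"
  by (rule square_summable_cmult)

definition cinner :: "ell2 \<Rightarrow> ell2 \<Rightarrow> complex" where
  "cinner u v = (\<Sum>\<^sub>\<infinity>n. cnj (ell2_nth u n) * ell2_nth v n)"

lemma Re_cinner: "Re (cinner u v) = inner u v"
  unfolding cinner_def inner_ell2_def
  by (subst infsum_Re[OF ell2_cinner_summable, symmetric]) (simp add: inner_complex_def)

lift_definition delta :: "int \<Rightarrow> ell2" is "\<lambda>m n. if n = m then 1 else 0"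
proof -
  fix m :: int
  have "(\<lambda>n. (cmod (if n = m then 1 else 0))\<^sup>2) summable_on {m}" by simp
  then show "(\<lambda>n. (cmod (if n = m then 1 else 0))\<^sup>2) summable_on UNIV"
    by (rule summable_on_cong_neutral[THEN iffD1, rotated -1]) auto
qed

lemma norm_cscale: "norm (cscale c u) = cmod c * norm u"
  by (simp add: norm_ell2_def cscale.rep_eq norm_mult power_mult_distrib infsum_cmult_right'
      real_sqrt_mult)

lemma cinner_delta: "cinner (delta n) u = ell2_nth u n"
proof -
  have "cinner (delta n) u = (\<Sum>\<^sub>\<infinity>k\<in>{n}. cnj (ell2_nth (delta n) k) * ell2_nth u k)"
    unfolding cinner_def by (rule infsum_cong_neutral) (auto simp: delta.rep_eq)
  then show ?thesis by (simp add: delta.rep_eq)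
qed

lemma norm_delta: "norm (delta n) = 1"
proof -
  have "inner (delta n) (delta n) = 1"
    by (simp add: Re_cinner[symmetric] cinner_delta delta.rep_eq)
  then show ?thesis by (simp add: norm_eq_sqrt_inner)
qed


section \<open>Bounded operators\<close>

lemma bounded_linear_cscale: "bounded_linear (cscale c)"
  by (rule bounded_linear_intro[of _ "cmod c"])
    (auto intro!: ell2_eqI simp: cscale.rep_eq algebra_simps norm_cscale)

definition cscale_op :: "complex \<Rightarrow> (ell2 \<Rightarrow>\<^sub>L ell2) \<Rightarrow> (ell2 \<Rightarrow>\<^sub>L ell2)" where
  "cscale_op c A = Blinfun (cscale c) o\<^sub>L A"

lemma cscale_op_apply: "cscale_op c A u = cscale c (A u)"
  by (simp add: cscale_op_def bounded_linear_Blinfun_apply[OF bounded_linear_cscale])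

definition op_power :: "(ell2 \<Rightarrow>\<^sub>L ell2) \<Rightarrow> nat \<Rightarrow> (ell2 \<Rightarrow>\<^sub>L ell2)" where
  "op_power A k = ((\<lambda>B. A o\<^sub>L B) ^^ k) id_blinfun"

text \<open>The series converges in operator norm.\<close>

definition op_exp :: "(ell2 \<Rightarrow>\<^sub>L ell2) \<Rightarrow> (ell2 \<Rightarrow>\<^sub>L ell2)" where
  "op_exp A = (\<Sum>k. (1 / fact k) *\<^sub>R op_power A k)"

lemma op_power_Suc: "op_power A (Suc k) = A o\<^sub>L op_power A k"
  by (simp add: op_power_def)

lemma norm_op_power_le: "norm (op_power A k) \<le> norm A ^ k"
proof (induction k)
  case 0
  show ?case by (simp add: op_power_def norm_blinfun_id_le)
next
  case (Suc k)
  have "norm (op_power A (Suc k)) \<le> norm A * norm (op_power A k)"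
    unfolding op_power_Suc by (rule norm_blinfun_compose)
  also have "\<dots> \<le> norm A * norm A ^ k"
    by (intro mult_left_mono Suc.IH norm_ge_zero)
  finally show ?case by simp
qed

lemma summable_op_exp: "summable (\<lambda>k. (1 / fact k) *\<^sub>R op_power A k)"
proof (rule summable_comparison_test')
  show "summable (\<lambda>k. norm A ^ k /\<^sub>R fact k)"
    using summable_exp_generic[of "norm A"] .
  show "norm ((1 / fact k) *\<^sub>R op_power A k) \<le> norm A ^ k /\<^sub>R fact k" if "k \<ge> 0" for k
    using norm_op_power_le[of A k] by (simp add: divide_simps)
qed

text \<open>The propagator \<open>exp (- i t H)\<close>.\<close>

definition evolution :: "(ell2 \<Rightarrow>\<^sub>L ell2) \<Rightarrow> real \<Rightarrow> (ell2 \<Rightarrow>\<^sub>L ell2)" where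
  "evolution H t = op_exp (cscale_op (- \<i> * complex_of_real t) H)"

definition norm_l1_linf :: "(ell2 \<Rightarrow>\<^sub>L ell2) \<Rightarrow> real" where
  "norm_l1_linf A = (SUP (n, m)\<in>UNIV. cmod (cinner (delta n) (A (delta m))))"

text \<open>The supremum is over a bounded set of reals, hence genuine.\<close>

lemma bdd_above_norm_l1_linf:
  "bdd_above (range (\<lambda>(n, m). cmod (cinner (delta n) (blinfun_apply A (delta m)))))"
proof (rule bdd_aboveI2)
  fix p :: "int \<times> int"
  obtain n m where p: "p = (n, m)" by (cases p)
  have "cmod (ell2_nth (A (delta m)) n) \<le> norm (A (delta m))"
    by (rule cmod_ell2_nth_le_norm)
  also have "\<dots> \<le> norm A * norm (delta m)" by (rule norm_blinfun)
  finally show "(case p of (n, m) \<Rightarrow> cmod (cinner (delta n) (A (delta m)))) \<le> norm A"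
    by (simp add: p cinner_delta norm_delta)
qed


section \<open>Crystals\<close>

definition is_crystal :: "(ell2 \<Rightarrow>\<^sub>L ell2) \<Rightarrow> bool" where
  "is_crystal H \<longleftrightarrow> (\<exists>w :: int \<Rightarrow> real.
     (\<lambda>k. \<bar>w k\<bar>) summable_on UNIV \<and> (\<forall>k. w (- k) = w k) \<and> (\<forall>k. 0 \<le> w k) \<and>
     (\<forall>u n. ell2_nth (H u) n = (\<Sum>\<^sub>\<infinity>k. complex_of_real (w k) * ell2_nth u (n + k))))"

text \<open>
  Every admissible weight defines a bounded operator, so requiring boundedness in the type
  of \<^term>\<open>is_crystal\<close> excludes nothing.
\<close>

lift_definition shift :: "int \<Rightarrow> ell2 \<Rightarrow> ell2" is "\<lambda>k u n. u (n + k)"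
proof -
  fix k :: int and u :: "int \<Rightarrow> complex"
  assume "(\<lambda>n. (cmod (u n))\<^sup>2) summable_on UNIV"
  moreover have "bij (\<lambda>n. n + k)" by (rule bij_plus_right)
  ultimately show "(\<lambda>n. (cmod (u (n + k)))\<^sup>2) summable_on UNIV"
    using summable_on_reindex_bij_betw[of "\<lambda>n. n + k" UNIV UNIV "\<lambda>n. (cmod (u n))\<^sup>2"] by simp
qed

lemma norm_shift: "norm (shift k u) = norm u"
proof -
  have "bij (\<lambda>n. n + k)" by (rule bij_plus_right)
  then show ?thesis
    using infsum_reindex_bij_betw[of "\<lambda>n. n + k" UNIV UNIV "\<lambda>n. (cmod (ell2_nth u n))\<^sup>2"]
    by (simp add: norm_ell2_def shift.rep_eq)
qed

lemma crystal_exists: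
  fixes w :: "int \<Rightarrow> real"
  assumes w: "(\<lambda>k. \<bar>w k\<bar>) summable_on UNIV"
  shows "\<exists>H :: ell2 \<Rightarrow>\<^sub>L ell2. \<forall>u n.
    ell2_nth (H u) n = (\<Sum>\<^sub>\<infinity>k. complex_of_real (w k) * ell2_nth u (n + k))"
proof (intro exI allI)
  fix u :: ell2 and n :: int
  have bl: "bounded_linear (shift k)" for k
    by (rule bounded_linear_intro[of _ 1])
      (auto intro!: ell2_eqI simp: shift.rep_eq norm_shift)
  define S where "S k = Blinfun (shift k)" for k
  have S: "blinfun_apply (S k) = shift k" for k
    unfolding S_def by (rule bounded_linear_Blinfun_apply[OF bl])
  have nS: "norm (S k) \<le> 1" for k
    by (rule norm_blinfun_bound) (simp_all add: S norm_shift)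
  have sum: "(\<lambda>k. w k *\<^sub>R S k) summable_on UNIV"
  proof (rule Infinite_Sum.abs_summable_summable, rule Infinite_Sum.abs_summable_on_comparison_test)
    show "(\<lambda>k. norm (w k)) summable_on UNIV" using w by simp
    show "norm (w k *\<^sub>R S k) \<le> norm (w k)" for k
      using nS[of k] by (simp add: mult_left_le)
  qed
  have "bounded_linear (\<lambda>A :: ell2 \<Rightarrow>\<^sub>L ell2. ell2_nth (blinfun_apply A u) n)"
    by (intro bounded_linear_compose[OF bounded_linear_ell2_nth] bounded_linear_intros)
  from has_sum_bounded_linear[OF this has_sum_infsum[OF sum], THEN infsumI]
  show "ell2_nth ((\<Sum>\<^sub>\<infinity>k. w k *\<^sub>R Blinfun (shift k)) u) n
      = (\<Sum>\<^sub>\<infinity>k. complex_of_real (w k) * ell2_nth u (n + k))"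
    by (simp add: blinfun.scaleR_left S shift.rep_eq scaleR_conv_of_real flip: S_def)
qed

end

theory Submission
  imports Defs "HOL-Complex_Analysis.Conformal_Mappings"
begin

text \<open>
  Expanding the propagator in powers of \<open>t\<close> gives
  \<open>F t = \<langle>\<delta>\<^sub>0, exp (- i t H) \<delta>\<^sub>0\<rangle> = (\<Sum>k. a k * t ^ k / k!)\<close> with
  \<open>a k = \<langle>\<delta>\<^sub>0, (- i H)\<^sup>k \<delta>\<^sub>0\<rangle>\<close>, so \<open>\<bar>a k\<bar> \<le> A ^ k\<close> with \<open>A = 1 + \<parallel>H\<parallel>\<close>, and \<open>a 0 = 1\<close>.  Thus \<open>F\<close>
  is an entire function of exponential type, and such a function cannot decay exponentially in both
  directions of the real line unless it vanishes identically.

  The reason is a continuation argument for the Laplace transform.  Integrating \<open>exp (- s x) F x\<close>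
  over \<open>[0, \<infinity>)\<close> for \<open>Re s > A\<close>, term by term in the series of \<open>F\<close>, gives the Borel
  transform \<open>B s = (\<Sum>k. a k / s ^ (k + 1))\<close>, which is holomorphic for \<open>\<bar>s\<bar> > A\<close> and tends to \<open>0\<close> at infinity.  If \<open>\<bar>F t\<bar> \<le> C exp (- c \<bar>t\<bar>)\<close>, the
  integral over \<open>[0, \<infinity>)\<close> converges for \<open>Re s > - c\<close> and continues \<open>B\<close> to that half-plane
  (\<open>laplace_continuation\<close>).  The same argument for \<open>F (- t)\<close> continues \<open>B\<close> to \<open>Re s < c\<close>.  The two
  half-planes cover the plane and overlap in a strip, so the continuations fit together to an entire
  function that vanishes at infinity; by Liouville it is \<open>0\<close> (\<open>glued_continuation_eq_0\<close>).
  Hence \<open>B = 0\<close>, whereas \<open>s * B s\<close> tends to \<open>a 0\<close>, which is \<open>1\<close>.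

  The norm from \<open>\<ell>\<^sup>1\<close> to \<open>\<ell>\<^sup>\<infinity>\<close> dominates every matrix element, so the claim about dispersion follows.
\<close>

section \<open>Exponential generating functions of geometrically bounded sequences\<close>

definition exp_gen :: "(nat \<Rightarrow> complex) \<Rightarrow> complex \<Rightarrow> complex" where
  "exp_gen a z = (\<Sum>k. a k * z ^ k / fact k)"

lemma exp_gen_summable_bound:
  assumes a: "\<And>k. cmod (a k) \<le> M * A ^ k"
  shows "summable (\<lambda>k. a k * z ^ k / fact k)" "cmod (exp_gen a z) \<le> M * exp (A * cmod z)"
proof -
  have le: "norm (a k * z ^ k / fact k) \<le> M * ((A * cmod z) ^ k /\<^sub>R fact k)" for k
    using mult_right_mono[OF a, of "cmod z ^ k" k]
    by (simp add: norm_mult norm_divide norm_power power_mult_distrib divide_simps)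
  have s: "(\<lambda>k. M * ((A * cmod z) ^ k /\<^sub>R fact k)) sums (M * exp (A * cmod z))"
    by (intro sums_mult exp_converges)
  show "summable (\<lambda>k. a k * z ^ k / fact k)"
    by (rule summable_comparison_test'[OF sums_summable[OF s]]) (rule le)
  show "cmod (exp_gen a z) \<le> M * exp (A * cmod z)"
    unfolding exp_gen_def sums_unique[OF s]
    by (rule norm_suminf_le[OF le sums_summable[OF s]])
qed

lemma exp_gen_has_field_derivative:
  assumes a: "\<And>k. cmod (a k) \<le> M * A ^ k"
  shows "(exp_gen a has_field_derivative exp_gen (\<lambda>k. a (Suc k)) z) (at z)"
proof -
  have "((\<lambda>z. \<Sum>k. a k / fact k * z ^ k) has_field_derivative
      (\<Sum>k. diffs (\<lambda>k. a k / fact k) k * z ^ k)) (at z)"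
    by (rule termdiffs_strong_converges_everywhere) (use exp_gen_summable_bound(1)[OF a] in simp)
  moreover have "diffs (\<lambda>k. a k / fact k) k = a (Suc k) / fact k" for k
    unfolding diffs_def fact_Suc of_nat_mult
    by (simp add: field_simps del: of_nat_Suc)
  ultimately show ?thesis
    by (simp add: exp_gen_def[abs_def])
qed

lemma exp_gen_continuous_on:
  assumes a: "\<And>k. cmod (a k) \<le> M * A ^ k"
  shows "continuous_on S (exp_gen a)"
  using exp_gen_has_field_derivative[OF a] by (meson DERIV_isCont continuous_at_imp_continuous_on)

section \<open>The Borel transform and the Laplace transform\<close>

text \<open>
  The series \<open>\<Sum>k. a k / s ^ (k + 1)\<close>, with one factor \<open>1 / s\<close> pulled out to leave a power series
  in \<open>1 / s\<close>.
\<close>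

definition borel_transform :: "(nat \<Rightarrow> complex) \<Rightarrow> complex \<Rightarrow> complex" where
  "borel_transform a s = inverse s * (\<Sum>k. a k * inverse s ^ k)"

context
  fixes a :: "nat \<Rightarrow> complex" and A :: real
  assumes A: "A > 0" and a: "\<And>k. cmod (a k) \<le> A ^ k"
begin

lemma borel_series_sums:
  assumes "cmod y < 1 / A"
  shows "(\<lambda>k. a k * y ^ k) sums (\<Sum>k. a k * y ^ k)"
proof (rule summable_sums, rule summable_comparison_test')
  show "summable (\<lambda>k. (A * cmod y) ^ k)"
    using assms A by (intro summable_geometric) (simp add: field_simps)
  show "norm (a k * y ^ k) \<le> (A * cmod y) ^ k" for k
    using mult_right_mono[OF a, of "cmod y ^ k" k] by (simp add: norm_mult norm_power power_mult_distrib)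
qed

lemma borel_series_holomorphic: "(\<lambda>y. \<Sum>k. a k * y ^ k) holomorphic_on ball 0 (1 / A)"
  by (rule power_series_holomorphic[where a = a]) (use borel_series_sums in simp)

lemma inverse_less_radius: "cmod s > A \<Longrightarrow> cmod (inverse s) < 1 / A"
  using A less_imp_inverse_less[of A "cmod s"] by (simp add: norm_inverse inverse_eq_divide norm_divide)

lemma borel_transform_holomorphic: "borel_transform a holomorphic_on {s. cmod s > A}"
proof -
  have "(\<lambda>s. \<Sum>k. a k * inverse s ^ k) holomorphic_on {s. cmod s > A}"
  proof (rule holomorphic_on_compose_gen[where f = inverse, unfolded o_def, OF _ borel_series_holomorphic])
    show "inverse holomorphic_on {s. cmod s > A}"
      using A by (intro holomorphic_intros) auto
  qed (use inverse_less_radius in auto)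
  then show ?thesis
    unfolding borel_transform_def[abs_def] using A by (intro holomorphic_intros) auto
qed

lemma borel_series_tendsto: "((\<lambda>s. \<Sum>k. a k * inverse s ^ k) \<longlongrightarrow> a 0) at_infinity"
proof -
  have "isCont (\<lambda>y. \<Sum>k. a k * y ^ k) 0"
    using borel_series_holomorphic A
    by (intro continuous_on_interior[of "ball 0 (1 / A)"] holomorphic_on_imp_continuous_on) auto
  then have "((\<lambda>y. \<Sum>k. a k * y ^ k) \<longlongrightarrow> a 0) (nhds 0)"
    using tendsto_at_iff_tendsto_nhds[of "\<lambda>y. \<Sum>k. a k * y ^ k" 0] by (simp add: isCont_def powser_zero)
  then show ?thesis
    by (rule filterlim_compose) (rule tendsto_inverse_0)
qed

lemma borel_transform_tendsto_0: "(borel_transform a \<longlongrightarrow> 0) at_infinity"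
  using tendsto_mult[OF tendsto_inverse_0 borel_series_tendsto]
  by (simp add: borel_transform_def[abs_def])

text \<open>
  With \<open>F = exp_gen a\<close>, the Laplace integrand \<open>exp (- s x) * F x\<close> has the explicit primitive
  \<open>W x = - exp (- s x) * (\<Sum>j. F\<^sup>(\<^sup>j\<^sup>) x / s ^ (j + 1))\<close>, the result of integrating by parts
  infinitely often; this replaces an interchange of sum and integral.  The second factor is itself an
  exponential generating function, whose coefficients \<open>d j\<close> are the Borel transforms of the shifted
  sequences and satisfy \<open>d (j + 1) = s * d j - a j\<close>.
\<close>

lemma exp_gen_laplace_primitive:
  assumes s: "cmod s > A"
  obtains W :: "real \<Rightarrow> complex" and M :: real where
    "\<And>x. (W has_vector_derivative exp (- s * of_real x) * exp_gen a (of_real x)) (at x)"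
    "W 0 = - borel_transform a s"
    "\<And>x. x \<ge> 0 \<Longrightarrow> cmod (W x) \<le> M * exp ((A - Re s) * x)"
proof -
  define d where "d j = inverse s * (\<Sum>k. a (k + j) * inverse s ^ k)" for j
  define M where "M = cmod (inverse s) * (1 / (1 - A * cmod (inverse s)))"
  have s0: "s \<noteq> 0" using s A by auto
  have r: "A * cmod (inverse s) < 1"
    using inverse_less_radius[OF s] A by (simp add: field_simps)
  have le: "norm (a (k + j) * inverse s ^ k) \<le> A ^ j * (A * cmod (inverse s)) ^ k" for k j
    using mult_right_mono[OF a, of "cmod (inverse s) ^ k" "k + j"]
    by (simp only: norm_mult norm_power power_mult_distrib power_add norm_ge_zero zero_le_power ac_simps simp_thms)
  have g: "(\<lambda>k. A ^ j * (A * cmod (inverse s)) ^ k) sums (A ^ j * (1 / (1 - A * cmod (inverse s))))" for j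
    using r A by (intro sums_mult geometric_sums) (simp add: abs_mult)
  have summ: "summable (\<lambda>k. a (k + j) * inverse s ^ k)" for j
    by (rule summable_comparison_test'[OF sums_summable[OF g]]) (rule le)
  have dle: "cmod (d j) \<le> M * A ^ j" for j
  proof -
    have "cmod (\<Sum>k. a (k + j) * inverse s ^ k) \<le> A ^ j * (1 / (1 - A * cmod (inverse s)))"
      unfolding sums_unique[OF g] by (rule norm_suminf_le[OF le sums_summable[OF g]])
    from mult_left_mono[OF this norm_ge_zero[of "inverse s"]] show ?thesis
      by (simp add: d_def M_def norm_mult ac_simps)
  qed
  have rec: "d (Suc j) = s * d j - a j" for j
  proof -
    have "(\<Sum>k. a (k + j) * inverse s ^ k) = a j + (\<Sum>k. a (Suc k + j) * inverse s ^ Suc k)"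
      using suminf_split_head[OF summ[of j]] by simp
    also have "(\<Sum>k. a (Suc k + j) * inverse s ^ Suc k) = inverse s * (\<Sum>k. a (k + Suc j) * inverse s ^ k)"
      by (subst suminf_mult[OF summ[of "Suc j"], symmetric]) (simp add: ac_simps)
    finally have "(\<Sum>k. a (k + j) * inverse s ^ k) = a j + d (Suc j)" by (simp only: d_def)
    then have "d j = inverse s * (a j + d (Suc j))" by (simp only: d_def[of j])
    then show ?thesis using s0 by (simp add: field_simps)
  qed
  \<comment> \<open>The recurrence for \<open>d\<close> is the differential equation \<open>D' = s * D - F\<close> for the generating
      functions \<open>D\<close> of \<open>d\<close> and \<open>F\<close> of \<open>a\<close>.\<close>
  have shift: "exp_gen (\<lambda>k. d (Suc k)) z = s * exp_gen d z - exp_gen a z" for z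
  proof -
    have sd: "summable (\<lambda>k. d k * z ^ k / fact k)"
      by (rule exp_gen_summable_bound(1)[OF dle])
    have sa: "summable (\<lambda>k. a k * z ^ k / fact k)"
      by (rule exp_gen_summable_bound(1)[of a 1 A]) (use a in simp)
    have "exp_gen (\<lambda>k. d (Suc k)) z = (\<Sum>k. s * (d k * z ^ k / fact k) - a k * z ^ k / fact k)"
      by (simp add: exp_gen_def rec algebra_simps diff_divide_distrib)
    also have "\<dots> = s * exp_gen d z - exp_gen a z"
      unfolding exp_gen_def by (simp only: suminf_diff[OF summable_mult[OF sd] sa, symmetric] suminf_mult[OF sd])
    finally show ?thesis .
  qed
  define V where "V z = - (exp (- s * z) * exp_gen d z)" for z
  have V: "(V has_field_derivative exp (- s * z) * exp_gen a z) (at z)" for z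
    unfolding V_def[abs_def]
    by (rule derivative_eq_intros exp_gen_has_field_derivative[OF dle] refl)+
      (simp add: shift algebra_simps)
  show ?thesis
  proof (rule that[of "\<lambda>x. V (of_real x)" M])
    show "((\<lambda>x. V (of_real x)) has_vector_derivative
        exp (- s * of_real x) * exp_gen a (of_real x)) (at x)" for x :: real
      using has_vector_derivative_real_field[OF V] by simp
    have "exp_gen d 0 = d 0"
      using powser_zero[of "\<lambda>k. d k / fact k"] by (simp add: exp_gen_def)
    then show "V (of_real 0) = - borel_transform a s"
      by (simp add: V_def d_def borel_transform_def)
    fix x :: real assume x: "x \<ge> 0"
    have "cmod (V (of_real x)) \<le> exp (- Re s * x) * (M * exp (A * x))"
      using mult_left_mono[OF exp_gen_summable_bound(2)[OF dle, of "of_real x"], of "exp (- Re s * x)"] x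
      by (simp add: V_def norm_mult)
    also have "\<dots> = M * exp ((A - Re s) * x)"
      by (simp add: algebra_simps flip: exp_add)
    finally show "cmod (V (of_real x)) \<le> M * exp ((A - Re s) * x)" .
  qed
qed

text \<open>
  The continuation is the Laplace transform itself, written as the sum of the integrals over
  \<open>[n, n + 1]\<close>.  Decay of \<open>F = exp_gen a\<close> makes these sums converge locally uniformly for \<open>Re s > - c\<close>, and for
  \<open>Re s > A\<close> they telescope along the primitive above, which then vanishes at infinity.
\<close>

lemma laplace_continuation:
  assumes decay: "\<And>t. t \<ge> 0 \<Longrightarrow> cmod (exp_gen a (of_real t)) \<le> C * exp (- c * t)"
  obtains G where "G holomorphic_on {s. Re s > - c}"
    "\<And>s. Re s > A \<Longrightarrow> G s = borel_transform a s"
proof -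
  define f where "f s x = exp (- s * of_real x) * exp_gen a (of_real x)" for s and x :: real
  define g where "g n s = integral {real n..real (Suc n)} (f s)" for n s
  define G where "G s = (\<Sum>n. g n s)" for s
  have a1: "cmod (a k) \<le> 1 * A ^ k" for k using a by simp
  have contF: "continuous_on S (\<lambda>x::real. exp_gen a (of_real x))" for S
    by (rule continuous_on_compose2[OF exp_gen_continuous_on[OF a1, of UNIV]])
      (auto intro!: continuous_intros)
  have contf: "continuous_on S (f s)" for s S
    unfolding f_def[abs_def] by (intro continuous_intros contF)
  have C: "C \<ge> 0"
    using order_trans[OF norm_ge_zero decay[of 0]] by simp
  have gle: "cmod (g n s) \<le> C * exp (- e) ^ n" if e: "e \<ge> 0" "Re s \<ge> - c + e" for n s e
  proof -
    have "cmod (f s x) \<le> C * exp (- e) ^ n" if x: "x \<in> {real n..real (Suc n)}" for x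
    proof -
      have x0: "x \<ge> 0" using x by (auto intro: order_trans[OF of_nat_0_le_iff])
      have "e * real n \<le> e * x" using e(1) x by (intro mult_left_mono) auto
      also have "\<dots> \<le> (Re s + c) * x" using e(2) x0 by (intro mult_right_mono) auto
      finally have le: "- (Re s * x) - c * x \<le> real n * - e" by (simp add: algebra_simps)
      have "cmod (f s x) \<le> exp (- (Re s * x)) * (C * exp (- c * x))"
        using mult_left_mono[OF decay[OF x0], of "exp (- (Re s * x))"]
        by (simp add: f_def norm_mult)
      also have "\<dots> = C * exp (- (Re s * x) - c * x)"
        by (simp flip: exp_add)
      also have "\<dots> \<le> C * exp (real n * - e)"
        using le C by (intro mult_left_mono) auto
      finally show ?thesis by (simp only: exp_of_nat_mult)
    qed
    from integral_bound[of "real n" "real (Suc n)", OF _ contf this] show ?thesis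
      by (simp add: g_def)
  qed
  have "G holomorphic_on {s. Re s > - c}"
  proof (rule holomorphic_uniform_sequence)
    show "open {s. Re s > - c}" by (rule open_halfspace_Re_gt)
    show "(\<lambda>s. \<Sum>k<n. g k s) holomorphic_on {s. Re s > - c}" for n
    proof (rule holomorphic_on_sum)
      fix k
      have "(\<lambda>s. integral (cbox (real k) (real (Suc k))) (f s)) holomorphic_on {s. Re s > - c}"
      proof (rule leibniz_rule_holomorphic)
        show "((\<lambda>s. f s x) has_field_derivative - of_real x * f s x) (at s within {s. Re s > - c})"
          for s and x :: real
          unfolding f_def by (auto intro!: derivative_eq_intros)
        show "f s integrable_on cbox (real k) (real (Suc k))" for s
          by (rule integrable_continuous[OF contf])
        show "continuous_on ({s. Re s > - c} \<times> cbox (real k) (real (Suc k)))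
            (\<lambda>(s, x). - of_real x * f s x)"
          unfolding f_def case_prod_unfold
          by (intro continuous_intros continuous_on_compose2[OF contF[of UNIV]]) auto
        show "convex {s. Re s > - c}" by (rule convex_halfspace_Re_gt)
      qed
      then show "g k holomorphic_on {s. Re s > - c}" by (simp add: g_def[abs_def])
    qed
    fix s assume "s \<in> {s. Re s > - c}"
    \<comment> \<open>Half the distance to the boundary line: \<open>Re z + c\<close> stays above \<open>e\<close> on the disc, so one
        geometric series with ratio \<open>exp (- e)\<close> dominates there.\<close>
    define e where "e = (Re s + c) / 2"
    have e: "e > 0" using \<open>s \<in> _\<close> by (simp add: e_def)
    have near: "Re z \<ge> - c + e" if "z \<in> cball s e" for z
    proof -
      have "Re s - Re z \<le> e"
        using that abs_Re_le_cmod[of "s - z"] by (simp add: dist_norm)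
      then show ?thesis by (simp add: e_def field_simps)
    qed
    have "uniform_limit (cball s e) (\<lambda>n z. \<Sum>k<n. g k z) G sequentially"
      unfolding G_def[abs_def]
    proof (rule Weierstrass_m_test)
      show "norm (g n z) \<le> C * exp (- e) ^ n" if "z \<in> cball s e" for n z
        using e near[OF that] by (intro gle) auto
      show "summable (\<lambda>n. C * exp (- e) ^ n)"
        using e by (intro summable_mult summable_geometric) simp
    qed
    moreover have "cball s e \<subseteq> {s. Re s > - c}" using near e by force
    ultimately show "\<exists>d>0. cball s d \<subseteq> {s. Re s > - c} \<and>
        uniform_limit (cball s d) (\<lambda>n z. \<Sum>k<n. g k z) G sequentially"
      using e by blast
  qed
  moreover have "G s = borel_transform a s" if s: "Re s > A" for s
  proof -
    have "cmod s > A" using s complex_Re_le_cmod[of s] by linarith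
    then obtain W M where W:
      "\<And>x. (W has_vector_derivative exp (- s * of_real x) * exp_gen a (of_real x)) (at x)"
      "W 0 = - borel_transform a s"
      "\<And>x. x \<ge> 0 \<Longrightarrow> cmod (W x) \<le> M * exp ((A - Re s) * x)"
      using exp_gen_laplace_primitive by blast
    have g: "g n s = W (real (Suc n)) - W (real n)" for n
      unfolding g_def f_def
      by (rule integral_unique, rule fundamental_theorem_of_calculus)
        (simp, rule has_vector_derivative_at_within[OF W(1)])
    have "(\<lambda>n. W (real n)) \<longlonglongrightarrow> 0"
    proof (rule Lim_null_comparison)
      show "\<forall>\<^sub>F n in sequentially. norm (W (real n)) \<le> M * exp (A - Re s) ^ n"
        using W(3)[of "real n" for n] by (intro always_eventually) (simp add: exp_of_nat_mult[symmetric] mult.commute)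
      show "(\<lambda>n. M * exp (A - Re s) ^ n) \<longlonglongrightarrow> 0"
        using s by (intro tendsto_mult_right_zero LIMSEQ_power_zero) simp
    qed
    from telescope_sums[OF this] show ?thesis
      by (simp add: G_def g sums_iff W(2) del: of_nat_Suc)
  qed
  ultimately show ?thesis by (rule that)
qed

end

section \<open>Functions of exponential type do not decay exponentially in both directions\<close>

text \<open>
  The crux is that \<open>G\<close> and \<open>K\<close> agree on the strip where both are defined.  They do so because
  the part of the strip with \<open>Im z > A\<close> can be reached inside \<open>\<bar>z\<bar> > A\<close> from the right and
  from the left, through convex sets on which \<open>G\<close>, respectively \<open>K\<close>, still equals \<open>B\<close>.
\<close>

lemma glued_continuation_eq_0:
  fixes B :: "complex \<Rightarrow> complex"
  assumes A: "A > 0" and c: "c > 0"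
    and B: "B holomorphic_on {s. cmod s > A}" "(B \<longlongrightarrow> 0) at_infinity"
    and G: "G holomorphic_on {s. Re s > - c}" "\<And>s. Re s > A \<Longrightarrow> G s = B s"
    and K: "K holomorphic_on {s. Re s < c}" "\<And>s. Re s < - A \<Longrightarrow> K s = B s"
    and s: "cmod s > A"
  shows "B s = 0"
proof -
  have im: "cmod z > A" if "Im z > A" for z
    using that abs_Im_le_cmod[of z] by linarith
  have GB: "G z = B z" if z: "Re z > - c" "Im z > A" for z
  proof (rule analytic_continuation_open[where f = G and g = B and z = z])
    show "open ({z. Re z > A} \<inter> {z. Im z > A})"
      by (intro open_Int open_halfspace_Re_gt open_halfspace_Im_gt)
    show "open ({z. Re z > - c} \<inter> {z. Im z > A})"
      by (intro open_Int open_halfspace_Re_gt open_halfspace_Im_gt)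
    have "Complex (A + 1) (A + 1) \<in> {z. Re z > A} \<inter> {z. Im z > A}" by simp
    then show "{z. Re z > A} \<inter> {z. Im z > A} \<noteq> {}" by blast
    show "connected ({z. Re z > - c} \<inter> {z. Im z > A})"
      by (intro convex_connected convex_Int convex_halfspace_Re_gt convex_halfspace_Im_gt)
    show "G holomorphic_on {z. Re z > - c} \<inter> {z. Im z > A}"
      by (rule holomorphic_on_subset[OF G(1)]) auto
    show "B holomorphic_on {z. Re z > - c} \<inter> {z. Im z > A}"
      by (rule holomorphic_on_subset[OF B(1)]) (use im in auto)
  qed (use G(2) A c z in auto)
  have KB: "K z = B z" if z: "Re z < c" "Im z > A" for z
  proof (rule analytic_continuation_open[where f = K and g = B and z = z])
    show "open ({z. Re z < - A} \<inter> {z. Im z > A})"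
      by (intro open_Int open_halfspace_Re_lt open_halfspace_Im_gt)
    show "open ({z. Re z < c} \<inter> {z. Im z > A})"
      by (intro open_Int open_halfspace_Re_lt open_halfspace_Im_gt)
    have "Complex (- A - 1) (A + 1) \<in> {z. Re z < - A} \<inter> {z. Im z > A}" by simp
    then show "{z. Re z < - A} \<inter> {z. Im z > A} \<noteq> {}" by blast
    show "connected ({z. Re z < c} \<inter> {z. Im z > A})"
      by (intro convex_connected convex_Int convex_halfspace_Re_lt convex_halfspace_Im_gt)
    show "K holomorphic_on {z. Re z < c} \<inter> {z. Im z > A}"
      by (rule holomorphic_on_subset[OF K(1)]) auto
    show "B holomorphic_on {z. Re z < c} \<inter> {z. Im z > A}"
      by (rule holomorphic_on_subset[OF B(1)]) (use im in auto)
  qed (use K(2) A c z in auto)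
  have GK: "G z = K z" if z: "Re z > - c" "Re z < c" for z
  proof (rule analytic_continuation_open[where f = G and g = K and z = z])
    show "open ({z. Re z > - c} \<inter> {z. Re z < c} \<inter> {z. Im z > A})"
      by (intro open_Int open_halfspace_Re_lt open_halfspace_Re_gt open_halfspace_Im_gt)
    show "open ({z. Re z > - c} \<inter> {z. Re z < c})"
      by (intro open_Int open_halfspace_Re_lt open_halfspace_Re_gt)
    have "Complex 0 (A + 1) \<in> {z. Re z > - c} \<inter> {z. Re z < c} \<inter> {z. Im z > A}" using c by simp
    then show "{z. Re z > - c} \<inter> {z. Re z < c} \<inter> {z. Im z > A} \<noteq> {}" by blast
    show "connected ({z. Re z > - c} \<inter> {z. Re z < c})"
      by (intro convex_connected convex_Int convex_halfspace_Re_lt convex_halfspace_Re_gt)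
    show "G holomorphic_on {z. Re z > - c} \<inter> {z. Re z < c}"
      by (rule holomorphic_on_subset[OF G(1)]) auto
    show "K holomorphic_on {z. Re z > - c} \<inter> {z. Re z < c}"
      by (rule holomorphic_on_subset[OF K(1)]) auto
  qed (use GB KB z in auto)
  define E where "E z = (if z \<in> {z. Re z > - c} then G z else K z)" for z
  have "E holomorphic_on ({z. Re z > - c} \<union> {z. Re z < c})"
    unfolding E_def[abs_def]
    by (rule holomorphic_on_If_Un[OF G(1) K(1) open_halfspace_Re_gt open_halfspace_Re_lt])
      (use GK in auto)
  moreover have "{z. Re z > - c} \<union> {z. Re z < c} = UNIV" using c by auto
  ultimately have E: "E holomorphic_on UNIV" by simp
  have EB: "E z = B z" if z: "cmod z > A" for z
  proof (rule analytic_continuation_open[where f = E and g = B and z = z])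
    have eq: "{z. cmod z > A} = - cball 0 A" by auto
    show "open {z. Re z > A}" by (rule open_halfspace_Re_gt)
    show "open {z. cmod z > A}" unfolding eq by (intro open_Compl closed_cball)
    have "of_real (A + 1) \<in> {z. Re z > A}" by simp
    then show "{z. Re z > A} \<noteq> {}" by blast
    show "connected {z. cmod z > A}"
      unfolding eq by (rule connected_complement_bounded_convex) auto
    show "{z. Re z > A} \<subseteq> {z. cmod z > A}"
      using complex_Re_le_cmod by (auto intro: less_le_trans)
    show "E holomorphic_on {z. cmod z > A}"
      by (rule holomorphic_on_subset[OF E]) simp
  qed (use B(1) G(2) A c z in \<open>auto simp: E_def\<close>)
  have "\<forall>\<^sub>F z in at_infinity. E z = B z"
    unfolding eventually_at_infinity by (rule exI[of _ "A + 1"]) (use EB in auto)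
  then have "(E \<longlongrightarrow> 0) at_infinity"
    using B(2) by (simp add: tendsto_cong)
  with E have "E s = 0" by (rule Liouville_weak)
  then show ?thesis using EB[OF s] by simp
qed

text \<open>
  Passing from \<open>a k\<close> to \<open>(- 1) ^ k * a k\<close> reflects \<open>F = exp_gen a\<close> at the origin and turns the Borel transform
  \<open>B\<close> into \<open>s \<mapsto> - B (- s)\<close>, so decay along the negative half-line gives the left continuation.
\<close>

lemma exp_gen_not_exp_decaying:
  assumes A: "A > 0" and a: "\<And>k. cmod (a k) \<le> A ^ k" and a0: "a 0 \<noteq> 0"
    and c: "c > 0" and decay: "\<And>t :: real. cmod (exp_gen a (of_real t)) \<le> C * exp (- c * \<bar>t\<bar>)"
  shows False
proof -
  define b where "b k = (- 1) ^ k * a k" for k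
  have b: "cmod (b k) \<le> A ^ k" for k
    using a by (simp add: b_def norm_mult norm_power)
  have reflect: "exp_gen b z = exp_gen a (- z)" for z
    by (simp add: exp_gen_def b_def power_minus[of z] mult_ac)
  have borel_reflect: "borel_transform b (- s) = - borel_transform a s" for s
  proof -
    have "(- 1) ^ k * (- inverse s) ^ k = inverse s ^ k" for k
      using power_mult_distrib[of "- 1" "- inverse s" k] by simp
    then have "b k * inverse (- s) ^ k = a k * inverse s ^ k" for k
      by (simp add: b_def mult_ac)
    then show ?thesis by (simp add: borel_transform_def)
  qed
  have decay_a: "cmod (exp_gen a (of_real t)) \<le> C * exp (- c * t)" if "t \<ge> 0" for t :: real
    using decay[of t] that by simp
  have decay_b: "cmod (exp_gen b (of_real t)) \<le> C * exp (- c * t)" if "t \<ge> 0" for t :: real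
    using decay[of "- t"] that by (simp add: reflect)
  obtain G where G: "G holomorphic_on {s. Re s > - c}"
    "\<And>s. Re s > A \<Longrightarrow> G s = borel_transform a s"
    using laplace_continuation[OF A a decay_a] by blast
  obtain L where L: "L holomorphic_on {s. Re s > - c}"
    "\<And>s. Re s > A \<Longrightarrow> L s = borel_transform b s"
    using laplace_continuation[OF A b decay_b] by blast
  have "(L \<circ> uminus) holomorphic_on {s. Re s < c}"
    by (rule holomorphic_on_compose_gen[OF _ L(1)])
      (use holomorphic_on_minus[OF holomorphic_on_ident] in auto)
  then have K: "(\<lambda>s. - L (- s)) holomorphic_on {s. Re s < c}"
    unfolding o_def by (rule holomorphic_on_minus)
  have zero: "borel_transform a s = 0" if "cmod s > A" for s
    by (rule glued_continuation_eq_0[OF A c borel_transform_holomorphic[OF A a]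
          borel_transform_tendsto_0[OF A a] G K _ that])
      (simp_all add: L(2) borel_reflect)
  have "\<forall>\<^sub>F s in at_infinity. (\<Sum>k. a k * inverse s ^ k) = 0"
    unfolding eventually_at_infinity
  proof (intro exI[of _ "A + 1"] allI impI)
    fix s :: complex assume "A + 1 \<le> norm s"
    then have "cmod s > A" "s \<noteq> 0" using A by auto
    then show "(\<Sum>k. a k * inverse s ^ k) = 0" using zero[of s] by (simp add: borel_transform_def)
  qed
  then have "((\<lambda>s. \<Sum>k. a k * inverse s ^ k) \<longlongrightarrow> 0) at_infinity"
    by (rule tendsto_eventually)
  from tendsto_unique[OF trivial_limit_at_infinity this borel_series_tendsto[OF A a]] a0 show False by simp
qed

section \<open>Matrix elements of the propagator\<close>

lemma op_power_scaleR: "op_power (t *\<^sub>R B) k = t ^ k *\<^sub>R op_power B k"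
proof (induction k)
  case (Suc k)
  then show ?case
    by (simp add: op_power_Suc blinfun_eqI blinfun.scaleR_left blinfun.scaleR_right)
qed (simp add: op_power_def)

lemma evolution_matrix_element:
  "cinner (delta n) (evolution H t (delta m)) =
    exp_gen (\<lambda>k. cinner (delta n) (op_power (cscale_op (- \<i>) H) k (delta m))) (of_real t)"
proof -
  have "cscale_op (- \<i> * of_real t) H = t *\<^sub>R cscale_op (- \<i>) H"
    by (rule blinfun_eqI, rule ell2_eqI)
      (simp add: cscale_op_apply cscale.rep_eq blinfun.scaleR_left scaleR_conv_of_real)
  then have "evolution H t = (\<Sum>k. (t ^ k / fact k) *\<^sub>R op_power (cscale_op (- \<i>) H) k)"
    by (simp add: evolution_def op_exp_def op_power_scaleR)
  moreover have "summable (\<lambda>k. (t ^ k / fact k) *\<^sub>R op_power (cscale_op (- \<i>) H) k)"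
    using summable_op_exp[of "t *\<^sub>R cscale_op (- \<i>) H"] by (simp add: op_power_scaleR)
  moreover have "bounded_linear (\<lambda>B :: ell2 \<Rightarrow>\<^sub>L ell2. ell2_nth (B (delta m)) n)"
    by (intro bounded_linear_compose[OF bounded_linear_ell2_nth] bounded_linear_intros)
  ultimately have "ell2_nth (evolution H t (delta m)) n =
      (\<Sum>k. ell2_nth (((t ^ k / fact k) *\<^sub>R op_power (cscale_op (- \<i>) H) k) (delta m)) n)"
    using bounded_linear.suminf[of "\<lambda>B :: ell2 \<Rightarrow>\<^sub>L ell2. ell2_nth (B (delta m)) n"] by simp
  then show ?thesis
    by (simp add: exp_gen_def cinner_delta blinfun.scaleR_left scaleR_conv_of_real mult_ac)
qed

lemma op_power_matrix_element_bound:
  "cmod (cinner (delta n) (op_power B k (delta m))) \<le> norm B ^ k"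
proof -
  have "cmod (cinner (delta n) (op_power B k (delta m))) \<le> norm (op_power B k (delta m))"
    by (simp add: cinner_delta cmod_ell2_nth_le_norm)
  also have "\<dots> \<le> norm (op_power B k)"
    using norm_blinfun[of "op_power B k" "delta m"] by (simp add: norm_delta)
  also have "\<dots> \<le> norm B ^ k" by (rule norm_op_power_le)
  finally show ?thesis .
qed

text \<open>
  Decay for large \<open>\<bar>t\<bar>\<close> is turned into decay for all \<open>t\<close> at the cost of the constant: on
  \<open>\<bar>t\<bar> < T\<close> the a priori bound \<open>exp (A \<bar>t\<bar>)\<close> is at most \<open>exp (A T) * exp (c T) * exp (- c \<bar>t\<bar>)\<close>.
\<close>

lemma evolution_not_exp_decaying:
  fixes H :: "ell2 \<Rightarrow>\<^sub>L ell2"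
  assumes c: "c > 0"
    and ev: "\<forall>\<^sub>F t :: real in at_infinity.
      cmod (cinner (delta n) (evolution H t (delta n))) \<le> C * exp (- c * \<bar>t\<bar>)"
  shows False
proof -
  define B where "B = cscale_op (- \<i>) H"
  define a where "a k = cinner (delta n) (op_power B k (delta n))" for k
  \<comment> \<open>The summand \<open>1\<close> keeps \<open>A\<close> positive when \<open>H = 0\<close>.\<close>
  define A where "A = norm B + 1"
  have A: "A > 0" by (simp add: A_def add_nonneg_pos)
  have a: "cmod (a k) \<le> A ^ k" for k
    unfolding a_def A_def
    by (rule order_trans[OF op_power_matrix_element_bound power_mono]) auto
  have a1: "cmod (a k) \<le> 1 * A ^ k" for k using a by simp
  have a0: "a 0 \<noteq> 0" by (simp add: a_def op_power_def cinner_delta delta.rep_eq)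
  obtain T where T: "\<And>t :: real. T \<le> \<bar>t\<bar> \<Longrightarrow> cmod (exp_gen a (of_real t)) \<le> C * exp (- c * \<bar>t\<bar>)"
    using ev unfolding eventually_at_infinity evolution_matrix_element a_def B_def by auto
  define D where "D = max C (exp (A * T) * exp (c * T))"
  have "cmod (exp_gen a (of_real t)) \<le> D * exp (- c * \<bar>t\<bar>)" for t :: real
  proof (cases "T \<le> \<bar>t\<bar>")
    case True
    have "C * exp (- c * \<bar>t\<bar>) \<le> D * exp (- c * \<bar>t\<bar>)"
      by (intro mult_right_mono) (auto simp: D_def)
    then show ?thesis using T[OF True] by linarith
  next
    case False
    have "cmod (exp_gen a (of_real t)) \<le> exp (A * \<bar>t\<bar>)"
      using exp_gen_summable_bound(2)[OF a1, of "of_real t"] by simp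
    also have "\<dots> \<le> exp (A * T + (c * T + - c * \<bar>t\<bar>))"
    proof -
      have "A * \<bar>t\<bar> \<le> A * T" "c * \<bar>t\<bar> \<le> c * T"
        using False A c by (auto intro!: mult_left_mono)
      then show ?thesis by simp
    qed
    also have "\<dots> = exp (A * T) * exp (c * T) * exp (- c * \<bar>t\<bar>)"
      by (simp only: exp_add mult.assoc)
    also have "\<dots> \<le> D * exp (- c * \<bar>t\<bar>)"
      by (intro mult_right_mono) (auto simp: D_def)
    finally show ?thesis .
  qed
  then show False by (rule exp_gen_not_exp_decaying[OF A a a0 c])
qed

lemma matrix_element_le_norm_l1_linf:
  fixes B :: "ell2 \<Rightarrow>\<^sub>L ell2"
  shows "cmod (cinner (delta n) (B (delta m))) \<le> norm_l1_linf B"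
  using cSUP_upper[OF UNIV_I bdd_above_norm_l1_linf[of B], of "(n, m)"]
  by (simp add: norm_l1_linf_def)

theorem proposition1p2:
  fixes H :: "ell2 \<Rightarrow>\<^sub>L ell2"
  assumes "is_crystal H"
  shows "(\<not> (\<exists>C c :: real. C > 0 \<and> c > 0 \<and>
            (\<forall>\<^sub>F t :: real in at_infinity.
               cmod (cinner (delta 0) (evolution H t (delta 0))) \<le> C * exp (- c * \<bar>t\<bar>)))) \<and>
         (\<not> (\<exists>C c :: real. C > 0 \<and> c > 0 \<and>
            (\<forall>\<^sub>F t :: real in at_infinity.
               norm_l1_linf (evolution H t) \<le> C * exp (- c * \<bar>t\<bar>))))"
proof -
  have kernel: False if "c > 0" "\<forall>\<^sub>F t :: real in at_infinity.
      cmod (cinner (delta 0) (evolution H t (delta 0))) \<le> C * exp (- c * \<bar>t\<bar>)" for C c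
    by (rule evolution_not_exp_decaying[OF that])
  have False if c: "c > 0" and ev: "\<forall>\<^sub>F t :: real in at_infinity.
      norm_l1_linf (evolution H t) \<le> C * exp (- c * \<bar>t\<bar>)" for C c
    by (rule kernel[OF c])
      (rule eventually_mono[OF ev], rule order_trans[OF matrix_element_le_norm_l1_linf])
  with kernel show ?thesis by blast
qed

end
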